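(* Let $\mathcal S$ and $\mathcal A$ be compact. Let $\pi^m_\theta(a|s)=\sum_{k=1}^N\pi^w_\theta(k|s)\pi^c_\theta(a|s,k)$ be a mixture policy whose components are reparameterized: for $\epsilon\sim p(\cdot)$, $f_\theta(\epsilon;s,k)\sim\pi^c_\theta(\cdot|s,k)$, with $f_\theta(\cdot;s,k)$ invertible with inverse $f^{-1}_\theta(a;s,k)$. Assume $p(s'|s,a)$, $d_0(s)$, $r(s,a)$, $f_\theta(\epsilon;s,k)$, $f^{-1}_\theta(a;s,k)$, $\pi^w_\theta(k|s)$, $\pi^c_\theta(a|s,k)$, $p(\epsilon)$ and their derivatives are continuous in $s,a,s',\theta,\epsilon$, and that $Q_\phi(s,a)$ and its derivatives are continuous in $s$ and $a$. Define $\hat J(\pi^m_\theta)=\mathbb{E}_{s\sim\mathcal B,\,a\sim\pi^m_\theta(\cdot|s)}[Q_\phi(s,a)-\alpha\log\pi^m_\theta(a|s)]$. Then $$\nabla_\theta\hat J(\pi^m_\theta)=\mathbb{E}_{s\sim\mathcal B,\,k\sim\pi^w_\theta(\cdot|s),\,\epsilon\sim p}\Big[\nabla_\theta\log\pi^w_\theta(k|s)\big(Q_\phi(s,f_\theta(\epsilon;s,k))-\alpha\log\pi^m_\theta(f_\theta(\epsilon;s,k)|s)\big)+\nabla_\theta\big(Q_\phi(s,f_\theta(\epsilon;s,k))-\alpha\log\pi^m_\theta(f_\theta(\epsilon;s,k)|s)\big)\Big].$$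
   Context: $Q_\phi:\mathcal S\times\mathcal A\to\mathbb{R}$ is a fixed (learned) action-value estimate not depending on $\theta$; $\mathcal B$ is a fixed distribution over states (e.g. the state distribution of a replay buffer); $\alpha>0$. $\pi^w_\theta(\cdot|s)$ is a distribution on $\{1,\dots,N\}$. In the second term, $\nabla_\theta$ differentiates through $f_\theta$ and $\pi^m_\theta$. *)

theory Defs
  imports "HOL-Probability.Probability"
begin

definition C1_fun :: "('a::real_normed_vector \<Rightarrow> 'b::real_normed_vector) \<Rightarrow> bool" where
  "C1_fun g \<longleftrightarrow> (\<exists>g'. (\<forall>x. (g has_derivative blinfun_apply (g' x)) (at x)) \<and> continuous_on UNIV g')"

definition grad :: "('a::euclidean_space \<Rightarrow> real) \<Rightarrow> 'a \<Rightarrow> 'a" where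
  "grad g x = (\<Sum>b\<in>Basis. frechet_derivative g (at x) b *\<^sub>R b)"

definition has_gradient_at :: "('a::euclidean_space \<Rightarrow> real) \<Rightarrow> 'a \<Rightarrow> 'a \<Rightarrow> bool" where
  "has_gradient_at g v x \<longleftrightarrow> (g has_derivative (\<lambda>h. v \<bullet> h)) (at x)"

definition mixture_policy ::
  "nat \<Rightarrow> ('p \<Rightarrow> 's \<Rightarrow> nat \<Rightarrow> real) \<Rightarrow> ('p \<Rightarrow> 's \<Rightarrow> nat \<Rightarrow> 'a \<Rightarrow> real) \<Rightarrow> 'p \<Rightarrow> 's \<Rightarrow> 'a \<Rightarrow> real" where
  "mixture_policy N piw pic \<theta> s a = (\<Sum>k=1..N. piw \<theta> s k * pic \<theta> s k a)"

definition Jhat ::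
  "'s measure \<Rightarrow> 'a::euclidean_space set \<Rightarrow> ('s \<Rightarrow> 'a \<Rightarrow> real) \<Rightarrow> real \<Rightarrow> ('p \<Rightarrow> 's \<Rightarrow> 'a \<Rightarrow> real) \<Rightarrow> 'p \<Rightarrow> real" where
  "Jhat B A Q \<alpha> pim \<theta> = (LINT s|B. (LINT a:A|lborel. pim \<theta> s a * (Q s a - \<alpha> * ln (pim \<theta> s a))))"

end

theory Submission
  imports Defs
begin

text \<open>For \<open>s \<in> S\<close> the reparameterization \<open>\<epsilon> \<mapsto> f\<^sub>\<theta>(\<epsilon>; s, k)\<close> pushes the noise density \<open>p\<close>
  on \<open>E\<close> forward to the component density \<open>\<pi>\<^sup>c\<^sub>\<theta>(\<cdot>|s, k)\<close>, so the inner objective equals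
  \<open>\<Sum>\<^sub>k \<pi>\<^sup>w\<^sub>\<theta>(k|s) V\<^sub>k(\<theta>, s)\<close> with \<open>V\<^sub>k(\<theta>, s) = \<integral>\<^sub>E p(\<epsilon>) \<Phi>\<^sub>k(\<theta>, s, \<epsilon>) d\<epsilon>\<close> and
  \<open>\<Phi>\<^sub>k(\<theta>, s, \<epsilon>) = Q(s, f\<^sub>\<theta>(\<epsilon>; s, k)) - \<alpha> log \<pi>\<^sup>m\<^sub>\<theta>(f\<^sub>\<theta>(\<epsilon>; s, k)|s)\<close>.
  As \<open>\<pi>\<^sup>m > 0\<close> on \<open>S \<times> A\<close>, \<open>\<Phi>\<^sub>k\<close> is \<open>C\<^sup>1\<close> at every point of \<open>\<Theta> \<times> S \<times> E\<close>, and compactness of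
  \<open>S\<close> and \<open>E\<close> gives the uniform bounds needed to differentiate under both integrals. The product
  rule together with \<open>\<pi>\<^sup>w \<nabla> log \<pi>\<^sup>w = \<nabla>\<pi>\<^sup>w\<close> then produces the stated integrand.
  Off \<open>S\<close> the integrand is irrelevant for \<open>B\<close> but must still be Borel measurable, and there
  \<open>log \<pi>\<^sup>m\<close> may be singular; this needs a case analysis on where \<open>\<pi>\<^sup>m\<close> vanishes.\<close>

section \<open>\<open>C\<^sup>1\<close> functions relative to a set\<close>

text \<open>Unlike \<^const>\<open>C1_fun\<close>, this notion only constrains points of \<open>U\<close>, so it is preserved by
  \<open>ln\<close> on sets where the argument does not vanish.\<close>

definition C1_on :: "'a::real_normed_vector set \<Rightarrow> ('a \<Rightarrow> 'b::real_normed_vector) \<Rightarrow> bool" where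
  "C1_on U g \<longleftrightarrow>
    (\<exists>g'. (\<forall>x\<in>U. (g has_derivative g' x) (at x)) \<and> (\<forall>v. continuous_on U (\<lambda>x. g' x v)))"

lemma C1_onI:
  "(\<And>x. x \<in> U \<Longrightarrow> (g has_derivative g' x) (at x)) \<Longrightarrow> (\<And>v. continuous_on U (\<lambda>x. g' x v))
    \<Longrightarrow> C1_on U g"
  unfolding C1_on_def by blast

lemma C1_onE:
  assumes "C1_on U g"
  obtains g' where "\<And>x. x \<in> U \<Longrightarrow> (g has_derivative g' x) (at x)"
    and "\<And>v. continuous_on U (\<lambda>x. g' x v)"
  using assms unfolding C1_on_def by blast

lemma C1_on_imp_continuous_on: "C1_on U g \<Longrightarrow> continuous_on U g"
  by (elim C1_onE) (meson continuous_at_imp_continuous_on has_derivative_continuous)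

lemma C1_fun_imp_C1_on: "C1_fun g \<Longrightarrow> C1_on U g"
  unfolding C1_fun_def
  by (elim exE conjE, rule C1_onI) (auto intro: continuous_on_subset[OF blinfun.continuous_on] continuous_on_const)

lemma C1_fun_imp_continuous_on: "C1_fun g \<Longrightarrow> continuous_on U g"
  by (rule C1_on_imp_continuous_on[OF C1_fun_imp_C1_on])

lemma C1_on_const: "C1_on U (\<lambda>x. c)"
  by (rule C1_onI[where g'="\<lambda>x v. 0"]) auto

lemma C1_on_id: "C1_on U (\<lambda>x. x)"
  by (rule C1_onI) (auto intro: has_derivative_ident)

lemma C1_on_fst: "C1_on U g \<Longrightarrow> C1_on U (\<lambda>x. fst (g x))"
  by (elim C1_onE, rule C1_onI) (auto intro!: has_derivative_fst continuous_on_fst)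

lemma C1_on_snd: "C1_on U g \<Longrightarrow> C1_on U (\<lambda>x. snd (g x))"
  by (elim C1_onE, rule C1_onI) (auto intro!: has_derivative_snd continuous_on_snd)

lemma C1_on_Pair: "C1_on U f \<Longrightarrow> C1_on U g \<Longrightarrow> C1_on U (\<lambda>x. (f x, g x))"
  by (elim C1_onE, rule C1_onI) (auto intro!: has_derivative_Pair continuous_on_Pair)

lemma C1_on_add: "C1_on U f \<Longrightarrow> C1_on U g \<Longrightarrow> C1_on U (\<lambda>x. f x + g x)"
  by (elim C1_onE, rule C1_onI) (auto intro!: has_derivative_add continuous_on_add)

lemma C1_on_diff: "C1_on U f \<Longrightarrow> C1_on U g \<Longrightarrow> C1_on U (\<lambda>x. f x - g x)"
  by (elim C1_onE, rule C1_onI) (auto intro!: has_derivative_diff continuous_on_diff)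

lemma C1_on_mult:
  fixes f g :: "'a::real_normed_vector \<Rightarrow> real"
  assumes f: "C1_on U f" and g: "C1_on U g"
  shows "C1_on U (\<lambda>x. f x * g x)"
proof -
  obtain f' where f': "\<And>x. x \<in> U \<Longrightarrow> (f has_derivative f' x) (at x)"
    "\<And>v. continuous_on U (\<lambda>x. f' x v)"
    using C1_onE[OF f] by blast
  obtain g' where g': "\<And>x. x \<in> U \<Longrightarrow> (g has_derivative g' x) (at x)"
    "\<And>v. continuous_on U (\<lambda>x. g' x v)"
    using C1_onE[OF g] by blast
  show ?thesis
  proof (rule C1_onI)
    show "((\<lambda>x. f x * g x) has_derivative (\<lambda>v. f x * g' x v + f' x v * g x)) (at x)" if "x \<in> U" for x
      using f'(1)[OF that] g'(1)[OF that] by (rule has_derivative_mult)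
    show "continuous_on U (\<lambda>x. f x * g' x v + f' x v * g x)" for v
      using C1_on_imp_continuous_on[OF f] C1_on_imp_continuous_on[OF g] f'(2) g'(2)
      by (intro continuous_intros)
  qed
qed

lemma C1_on_sum:
  "finite I \<Longrightarrow> (\<And>i. i \<in> I \<Longrightarrow> C1_on U (f i)) \<Longrightarrow> C1_on U (\<lambda>x. \<Sum>i\<in>I. f i x)"
  by (induction I rule: finite_induct) (auto intro: C1_on_add C1_on_const)

lemma C1_on_compose:
  assumes F: "C1_fun F" and g: "C1_on U g"
  shows "C1_on U (\<lambda>x. F (g x))"
proof -
  obtain F' where F': "\<And>y. (F has_derivative blinfun_apply (F' y)) (at y)" "continuous_on UNIV F'"
    using F unfolding C1_fun_def by blast
  obtain g' where g': "\<And>x. x \<in> U \<Longrightarrow> (g has_derivative g' x) (at x)"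
    "\<And>v. continuous_on U (\<lambda>x. g' x v)"
    using C1_onE[OF g] by blast
  show ?thesis
  proof (rule C1_onI)
    show "((\<lambda>x. F (g x)) has_derivative (\<lambda>v. F' (g x) (g' x v))) (at x)" if "x \<in> U" for x
      using diff_chain_at[OF g'(1)[OF that] F'(1)] by (simp add: o_def)
    have "continuous_on U (\<lambda>x. F' (g x))"
      using continuous_on_compose2[OF F'(2) C1_on_imp_continuous_on[OF g]] by simp
    then show "continuous_on U (\<lambda>x. F' (g x) (g' x v))" for v
      using g'(2) by (rule blinfun.continuous_on)
  qed
qed

lemma DERIV_ln_nonzero:
  fixes x :: real
  assumes "x \<noteq> 0"
  shows "(ln has_real_derivative inverse x) (at x)"
proof (cases "x > 0")
  case False
  then have "x < 0" using assms by simp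
  then have "((\<lambda>y. ln (- y)) has_real_derivative inverse (- x) * (- 1)) (at x)"
    by (auto intro!: derivative_eq_intros simp: divide_inverse)
  then show ?thesis by (simp add: ln_minus)
qed (simp add: DERIV_ln)

lemma C1_on_ln:
  fixes g :: "'a::real_normed_vector \<Rightarrow> real"
  assumes g: "C1_on U g" and nonzero: "\<And>x. x \<in> U \<Longrightarrow> g x \<noteq> 0"
  shows "C1_on U (\<lambda>x. ln (g x))"
proof -
  obtain g' where g': "\<And>x. x \<in> U \<Longrightarrow> (g has_derivative g' x) (at x)"
    "\<And>v. continuous_on U (\<lambda>x. g' x v)"
    using C1_onE[OF g] by blast
  show ?thesis
  proof (rule C1_onI)
    show "((\<lambda>x. ln (g x)) has_derivative (\<lambda>v. g' x v * inverse (g x))) (at x)" if "x \<in> U" for x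
      using DERIV_compose_FDERIV[OF DERIV_ln_nonzero[OF nonzero[OF that]] g'(1)[OF that]] .
    show "continuous_on U (\<lambda>x. g' x v * inverse (g x))" for v
      using C1_on_imp_continuous_on[OF g] g'(2) nonzero by (intro continuous_intros) auto
  qed
qed

lemma grad_eqI: "has_gradient_at g v x \<Longrightarrow> grad g x = v"
  unfolding grad_def has_gradient_at_def
  by (metis (no_types, lifting) euclidean_representation frechet_derivative_at inner_commute sum.cong)

lemma has_gradient_at_ln:
  assumes g: "has_gradient_at g v x" and nonzero: "g x \<noteq> 0"
  shows "has_gradient_at (\<lambda>x. ln (g x)) (inverse (g x) *\<^sub>R v) x"
proof -
  have "((\<lambda>x. ln (g x)) has_derivative (\<lambda>h. (v \<bullet> h) * inverse (g x))) (at x)"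
    using DERIV_compose_FDERIV[OF DERIV_ln_nonzero[OF nonzero] g[unfolded has_gradient_at_def]] .
  then show ?thesis by (simp add: has_gradient_at_def mult.commute)
qed

lemma C1_on_partial_grad:
  fixes \<Phi> :: "'p::euclidean_space \<times> 'y::real_normed_vector \<Rightarrow> real"
  assumes "C1_on U \<Phi>"
  shows "continuous_on U (\<lambda>z. grad (\<lambda>t. \<Phi> (t, snd z)) (fst z))"
    and "(\<theta>, y) \<in> U \<Longrightarrow> has_gradient_at (\<lambda>t. \<Phi> (t, y)) (grad (\<lambda>t. \<Phi> (t, y)) \<theta>) \<theta>"
proof -
  obtain \<Phi>' where \<Phi>': "\<And>z. z \<in> U \<Longrightarrow> (\<Phi> has_derivative \<Phi>' z) (at z)"
    "\<And>v. continuous_on U (\<lambda>z. \<Phi>' z v)"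
    using C1_onE[OF assms] by blast
  define D where "D z = (\<Sum>b\<in>Basis. \<Phi>' z (b, 0) *\<^sub>R b)" for z
  have D: "has_gradient_at (\<lambda>t. \<Phi> (t, y)) (D (\<theta>, y)) \<theta>" if "(\<theta>, y) \<in> U" for \<theta> y
  proof -
    have "((\<lambda>t. (t, y)) has_derivative (\<lambda>h. (h, 0))) (at \<theta>)"
      by (auto intro!: derivative_eq_intros)
    then have partial: "((\<lambda>t. \<Phi> (t, y)) has_derivative (\<lambda>h. \<Phi>' (\<theta>, y) (h, 0))) (at \<theta>)"
      using diff_chain_at[of "\<lambda>t. (t, y)" _ \<theta> \<Phi> "\<Phi>' (\<theta>, y)"] \<Phi>'(1) that by (simp add: o_def)
    have "\<Phi>' (\<theta>, y) (h, 0) = D (\<theta>, y) \<bullet> h" for h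
      using Linear_Algebra.linear_componentwise[OF has_derivative_linear[OF partial], of h 1]
      by (auto simp: D_def inner_sum_right inner_commute intro!: sum.cong)
    then show ?thesis using partial by (simp add: has_gradient_at_def)
  qed
  then have grad_D: "grad (\<lambda>t. \<Phi> (t, snd z)) (fst z) = D z" if "z \<in> U" for z
    using D[of "fst z" "snd z"] that by (intro grad_eqI) simp
  have "continuous_on U D"
    unfolding D_def using \<Phi>'(2) by (auto intro!: continuous_intros)
  then show "continuous_on U (\<lambda>z. grad (\<lambda>t. \<Phi> (t, snd z)) (fst z))"
    by (rule continuous_on_eq) (simp add: grad_D)
  show "(\<theta>, y) \<in> U \<Longrightarrow> has_gradient_at (\<lambda>t. \<Phi> (t, y)) (grad (\<lambda>t. \<Phi> (t, y)) \<theta>) \<theta>"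
    using D grad_D[of "(\<theta>, y)"] by simp
qed

section \<open>Differentiation under the integral sign\<close>

lemma gradient_linearization_bound:
  fixes g :: "'p::euclidean_space \<Rightarrow> real"
  assumes grad: "\<And>z. z \<in> ball x d \<Longrightarrow> has_gradient_at g (D z) z"
    and close: "\<And>z. z \<in> ball x d \<Longrightarrow> norm (D z - D x) \<le> c"
    and y: "y \<in> ball x d"
  shows "\<bar>g y - g x - D x \<bullet> (y - x)\<bar> \<le> norm (y - x) * c"
proof -
  have "dist x y < d" using y by simp
  then have "x \<in> ball x d" using zero_le_dist[of x y] by (simp del: zero_le_dist)
  moreover have "onorm ((\<lambda>h. D z \<bullet> h) - (\<lambda>h. D x \<bullet> h)) \<le> c" if "z \<in> ball x d" for z
  proof -
    have "(\<lambda>h. D z \<bullet> h) - (\<lambda>h. D x \<bullet> h) = (\<lambda>h. (D z - D x) \<bullet> h)"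
      by (auto simp: fun_eq_iff inner_diff_left)
    moreover have "onorm (\<lambda>h. (D z - D x) \<bullet> h) \<le> norm (D z - D x)"
      by (rule onorm_bound) (auto simp: Cauchy_Schwarz_ineq2)
    ultimately show ?thesis using close[OF that] by simp
  qed
  moreover have "x + t *\<^sub>R (y - x) \<in> ball x d" if "t \<in> {0..1}" for t
  proof -
    have "norm (t *\<^sub>R (y - x)) \<le> norm (y - x)"
      using that by (simp add: mult_left_le_one_le)
    then show ?thesis using y by (simp add: dist_norm norm_minus_commute)
  qed
  ultimately show ?thesis
    using differentiable_bound_linearization[of x y "ball x d" g "\<lambda>z h. D z \<bullet> h" x c] grad
    by (auto simp: has_gradient_at_def has_derivative_at_withinI)
qed

lemma integral_linearization_bound:
  fixes F :: "'p::euclidean_space \<Rightarrow> 'x \<Rightarrow> real" and D :: "'x \<Rightarrow> 'p"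
  assumes int: "integrable M (F y)" "integrable M (F \<theta>)" and intD: "integrable M D"
    and g: "integrable M g"
    and bound: "AE x in M. \<bar>F y x - F \<theta> x - D x \<bullet> (y - \<theta>)\<bar> \<le> c * g x"
  shows "\<bar>(LINT x|M. F y x) - (LINT x|M. F \<theta> x) - (LINT x|M. D x) \<bullet> (y - \<theta>)\<bar> \<le> c * (LINT x|M. g x)"
proof -
  have "(LINT x|M. F y x) - (LINT x|M. F \<theta> x) - (LINT x|M. D x) \<bullet> (y - \<theta>)
      = (LINT x|M. F y x - F \<theta> x - D x \<bullet> (y - \<theta>))"
    using int intD
    by (simp only: Bochner_Integration.integral_diff Bochner_Integration.integrable_diff
        integrable_inner_left integral_inner_left)
  also have "\<bar>\<dots>\<bar> \<le> (LINT x|M. \<bar>F y x - F \<theta> x - D x \<bullet> (y - \<theta>)\<bar>)"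
    using integral_norm_bound[of M "\<lambda>x. F y x - F \<theta> x - D x \<bullet> (y - \<theta>)"] by simp
  also have "\<dots> \<le> (LINT x|M. c * g x)"
    using bound int intD g by (intro integral_mono_AE) auto
  also have "\<dots> = c * (LINT x|M. g x)"
    by simp
  finally show ?thesis .
qed

lemma has_gradient_at_integral:
  fixes F :: "'p::euclidean_space \<Rightarrow> 'x \<Rightarrow> real" and D :: "'p \<Rightarrow> 'x \<Rightarrow> 'p"
  assumes int: "\<And>t. integrable M (F t)" and intD: "integrable M (D \<theta>)"
    and grad: "AE x in M. \<forall>t. has_gradient_at (\<lambda>t. F t x) (D t x) t"
    and g: "integrable M g"
    and modulus: "\<And>e. e > 0 \<Longrightarrow> \<exists>d>0. AE x in M. \<forall>t. dist t \<theta> < d \<longrightarrow> norm (D t x - D \<theta> x) \<le> e * g x"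
  shows "has_gradient_at (\<lambda>t. LINT x|M. F t x) (LINT x|M. D \<theta> x) \<theta>"
  unfolding has_gradient_at_def has_derivative_at_alt
proof (intro conjI allI impI bounded_linear_inner_right)
  fix e :: real assume e: "e > 0"
  define e' where "e' = e / (\<bar>LINT x|M. g x\<bar> + 1)"
  have "\<bar>LINT x|M. g x\<bar> + 1 > 0"
    by (simp add: add_nonneg_pos)
  then have "e' > 0" "e' * (\<bar>LINT x|M. g x\<bar> + 1) = e"
    unfolding e'_def using e by auto
  then have e': "e' > 0" "e' * (LINT x|M. g x) \<le> e"
    using mult_left_mono[of "LINT x|M. g x" "\<bar>LINT x|M. g x\<bar> + 1" e'] by auto
  obtain d where d: "d > 0"
    and close: "AE x in M. \<forall>t. dist t \<theta> < d \<longrightarrow> norm (D t x - D \<theta> x) \<le> e' * g x"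
    using modulus[OF e'(1)] by blast
  show "\<exists>d>0. \<forall>y. norm (y - \<theta>) < d \<longrightarrow>
      norm ((LINT x|M. F y x) - (LINT x|M. F \<theta> x) - (LINT x|M. D \<theta> x) \<bullet> (y - \<theta>)) \<le> e * norm (y - \<theta>)"
  proof (intro exI[of _ d] conjI allI impI d)
    fix y assume y: "norm (y - \<theta>) < d"
    have "AE x in M. \<bar>F y x - F \<theta> x - D \<theta> x \<bullet> (y - \<theta>)\<bar> \<le> (norm (y - \<theta>) * e') * g x"
      using grad close
    proof eventually_elim
      case (elim x)
      have "\<bar>F y x - F \<theta> x - D \<theta> x \<bullet> (y - \<theta>)\<bar> \<le> norm (y - \<theta>) * (e' * g x)"
        by (rule gradient_linearization_bound[where d=d])
           (use elim y in \<open>auto simp: dist_commute dist_norm norm_minus_commute\<close>)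
      then show ?case by (simp add: mult.assoc)
    qed
    then have "\<bar>(LINT x|M. F y x) - (LINT x|M. F \<theta> x) - (LINT x|M. D \<theta> x) \<bullet> (y - \<theta>)\<bar>
        \<le> (norm (y - \<theta>) * e') * (LINT x|M. g x)"
      by (rule integral_linearization_bound[OF int[of y] int[of \<theta>] intD g])
    also have "\<dots> \<le> e * norm (y - \<theta>)"
      using mult_left_mono[OF e'(2) norm_ge_zero[of "y - \<theta>"]] by (simp add: ac_simps)
    finally show "norm ((LINT x|M. F y x) - (LINT x|M. F \<theta> x) - (LINT x|M. D \<theta> x) \<bullet> (y - \<theta>))
        \<le> e * norm (y - \<theta>)" by simp
  qed
qed

lemma continuous_on_prod_compact_uniformE:
  fixes D :: "'p::metric_space \<Rightarrow> 'x::topological_space \<Rightarrow> 'b::metric_space"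
  assumes K: "compact K" and cont: "continuous_on (UNIV \<times> K) (\<lambda>z. D (fst z) (snd z))" and e: "e > 0"
  obtains d where "d > 0" "\<And>t x. dist t \<theta> < d \<Longrightarrow> x \<in> K \<Longrightarrow> dist (D t x) (D \<theta> x) \<le> e"
proof -
  obtain X where X: "\<theta> \<in> X" "open X" and close: "\<forall>t\<in>X \<inter> UNIV. \<forall>x\<in>K. dist (D t x) (D \<theta> x) \<le> e"
    using continuous_on_prod_compactE[OF cont K, of \<theta> e] e by auto
  obtain d where "d > 0" "ball \<theta> d \<subseteq> X"
    using X open_contains_ball by blast
  then show thesis
    using that[of d] close by (auto simp: dist_commute subset_iff)
qed

lemma has_gradient_at_integral_compact:
  fixes \<Phi> :: "'p::euclidean_space \<Rightarrow> 'x::metric_space \<Rightarrow> real" and D :: "'p \<Rightarrow> 'x \<Rightarrow> 'p"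
  assumes K: "compact K" and support: "AE x in M. x \<in> K \<or> w x = 0" and w: "integrable M w"
    and int: "\<And>t. integrable M (\<lambda>x. w x * \<Phi> t x)" and intD: "integrable M (\<lambda>x. w x *\<^sub>R D \<theta> x)"
    and grad: "\<And>t x. x \<in> K \<Longrightarrow> has_gradient_at (\<lambda>t. \<Phi> t x) (D t x) t"
    and cont: "continuous_on (UNIV \<times> K) (\<lambda>z. D (fst z) (snd z))"
  shows "has_gradient_at (\<lambda>t. LINT x|M. w x * \<Phi> t x) (LINT x|M. w x *\<^sub>R D \<theta> x) \<theta>"
proof (rule has_gradient_at_integral[where F="\<lambda>t x. w x * \<Phi> t x" and D="\<lambda>t x. w x *\<^sub>R D t x"])
  show "integrable M (\<lambda>x. w x * \<Phi> t x)" for t by (rule int)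
  show "integrable M (\<lambda>x. w x *\<^sub>R D \<theta> x)" by (rule intD)
  show "integrable M (\<lambda>x. norm (w x))" using w by simp
  show "AE x in M. \<forall>t. has_gradient_at (\<lambda>t. w x * \<Phi> t x) (w x *\<^sub>R D t x) t"
    using support
  proof eventually_elim
    case (elim x)
    show ?case
    proof (cases "x \<in> K")
      case True
      then show ?thesis
        by (auto simp: has_gradient_at_def inner_scaleR_left
            intro!: has_derivative_mult_right grad[unfolded has_gradient_at_def])
    qed (use elim in \<open>simp add: has_gradient_at_def\<close>)
  qed
  fix e :: real assume "e > 0"
  then obtain d where d: "d > 0" and close: "\<And>t x. dist t \<theta> < d \<Longrightarrow> x \<in> K \<Longrightarrow> dist (D t x) (D \<theta> x) \<le> e"
    using continuous_on_prod_compact_uniformE[OF K cont] by blast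
  have "AE x in M. \<forall>t. dist t \<theta> < d \<longrightarrow> norm (w x *\<^sub>R D t x - w x *\<^sub>R D \<theta> x) \<le> e * norm (w x)"
    using support
  proof eventually_elim
    case (elim x)
    show ?case
    proof (intro allI impI)
      fix t assume "dist t \<theta> < d"
      then have "x \<in> K \<Longrightarrow> norm (D t x - D \<theta> x) \<le> e"
        using close by (simp add: dist_norm)
      then show "norm (w x *\<^sub>R D t x - w x *\<^sub>R D \<theta> x) \<le> e * norm (w x)"
        using elim mult_left_mono[of "norm (D t x - D \<theta> x)" e "\<bar>w x\<bar>"]
        by (auto simp: scaleR_diff_right[symmetric] mult.commute)
    qed
  qed
  then show "\<exists>d>0. AE x in M. \<forall>t. dist t \<theta> < d \<longrightarrow> norm (w x *\<^sub>R D t x - w x *\<^sub>R D \<theta> x) \<le> e * norm (w x)"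
    using d by blast
qed

section \<open>Parametric integrals\<close>

lemma continuous_on_parametric_set_integral:
  fixes \<phi> :: "'y::topological_space \<times> 'e::euclidean_space \<Rightarrow> 'b::euclidean_space"
  assumes E: "compact E" and \<phi>: "continuous_on (T \<times> E) \<phi>" and w: "continuous_on E w"
  shows "continuous_on T (\<lambda>y. LINT x:E|lborel. w x *\<^sub>R \<phi> (y, x))"
  unfolding continuous_on_def
proof (intro strip tendstoI)
  fix y0 and e' :: real assume y0: "y0 \<in> T" and e': "e' > 0"
  define I where "I = (LINT x:E|lborel. \<bar>w x\<bar>)"
  define e where "e = e' / (I + 1)"
  have "I \<ge> 0" unfolding I_def set_lebesgue_integral_def by (intro integral_nonneg_AE) auto
  then have e: "e > 0" "e * I < e'" unfolding e_def using e' by (auto simp: field_simps)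
  have int: "set_integrable lborel E (\<lambda>x. w x *\<^sub>R \<phi> (y, x))" if "y \<in> T" for y
    unfolding set_integrable_def using that
    by (intro borel_integrable_compact[OF E] continuous_intros continuous_on_compose2[OF \<phi>] w) auto
  have int_w: "set_integrable lborel E (\<lambda>x. \<bar>w x\<bar>)"
    unfolding set_integrable_def using borel_integrable_compact[OF E continuous_on_rabs[OF w]] by simp
  obtain X where X: "y0 \<in> X" "open X"
    and close: "\<forall>y\<in>X \<inter> T. \<forall>x\<in>E. dist (\<phi> (y, x)) (\<phi> (y0, x)) \<le> e"
    using continuous_on_prod_compactE[OF \<phi> E y0 e(1)] by blast
  have "\<forall>\<^sub>F y in at y0 within T. y \<in> X \<inter> T"
    using X unfolding eventually_at_topological by blast
  then show "\<forall>\<^sub>F y in at y0 within T.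
      dist (LINT x:E|lborel. w x *\<^sub>R \<phi> (y, x)) (LINT x:E|lborel. w x *\<^sub>R \<phi> (y0, x)) < e'"
  proof (rule eventually_mono)
    fix y assume elim: "y \<in> X \<inter> T"
    have "dist (LINT x:E|lborel. w x *\<^sub>R \<phi> (y, x)) (LINT x:E|lborel. w x *\<^sub>R \<phi> (y0, x))
        = norm (LINT x:E|lborel. w x *\<^sub>R (\<phi> (y, x) - \<phi> (y0, x)))"
      using int[of y] int[OF y0] elim
      by (simp only: dist_norm scaleR_diff_right set_integral_diff(2) IntD2)
    also have "\<dots> \<le> (LINT x:E|lborel. norm (w x *\<^sub>R (\<phi> (y, x) - \<phi> (y0, x))))"
      using int[of y] int[OF y0] elim by (intro set_integral_norm_bound) (simp add: scaleR_diff_right)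
    also have "\<dots> \<le> (LINT x:E|lborel. \<bar>w x\<bar> * e)"
    proof (rule set_integral_mono)
      show "set_integrable lborel E (\<lambda>x. norm (w x *\<^sub>R (\<phi> (y, x) - \<phi> (y0, x))))"
        using int[of y] int[OF y0] elim by (intro set_integrable_norm) (simp add: scaleR_diff_right)
      show "set_integrable lborel E (\<lambda>x. \<bar>w x\<bar> * e)" using int_w by simp
      show "norm (w x *\<^sub>R (\<phi> (y, x) - \<phi> (y0, x))) \<le> \<bar>w x\<bar> * e" if "x \<in> E" for x
        using close elim that by (auto simp: dist_norm intro: mult_left_mono)
    qed
    also have "\<dots> = e * I" unfolding I_def by simp
    also have "\<dots> < e'" using e(2) .
    finally show "dist (LINT x:E|lborel. w x *\<^sub>R \<phi> (y, x)) (LINT x:E|lborel. w x *\<^sub>R \<phi> (y0, x)) < e'" .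
  qed
qed

lemma borel_measurable_parametric_set_integral:
  fixes F :: "'s::euclidean_space \<times> 'e::euclidean_space \<Rightarrow> 'b::{banach, second_countable_topology}"
  assumes F: "F \<in> borel_measurable borel" and E: "E \<in> sets borel"
  shows "(\<lambda>s. LINT x:E|lborel. F (s, x)) \<in> borel_measurable borel"
proof -
  have sets_eq: "sets (borel \<Otimes>\<^sub>M lborel) = sets (borel :: ('s \<times> 'e) measure)"
    by (metis borel_prod sets_lborel sets_pair_measure_cong)
  have "(\<lambda>z. snd z) \<in> borel_measurable (borel :: ('s \<times> 'e) measure)"
    by (intro borel_measurable_continuous_onI continuous_intros)
  then have "(\<lambda>z. indicator E (snd z) *\<^sub>R F z) \<in> borel_measurable (borel \<Otimes>\<^sub>M lborel)"
    unfolding measurable_cong_sets[OF sets_eq refl]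
    using E F by (intro borel_measurable_scaleR measurable_compose[OF _ borel_measurable_indicator])
  moreover have "(\<lambda>(s, x). indicator E x *\<^sub>R F (s, x)) = (\<lambda>z. indicator E (snd z) *\<^sub>R F z)"
    by auto
  ultimately show ?thesis
    unfolding set_lebesgue_integral_def by (intro lborel.borel_measurable_lebesgue_integral) simp
qed

lemma integral_density_pushforward:
  fixes T :: "'e::euclidean_space \<Rightarrow> 'a::euclidean_space" and h :: "'a \<Rightarrow> real"
  assumes T: "T \<in> borel_measurable borel"
    and u: "u \<in> borel_measurable borel" "\<And>x. 0 \<le> u x"
    and v: "v \<in> borel_measurable borel" "\<And>a. 0 \<le> v a"
    and push: "\<And>X. X \<in> sets borel \<Longrightarrow>
      (\<integral>\<^sup>+x. ennreal (u x) * indicator X (T x) \<partial>lborel) = (\<integral>\<^sup>+a. ennreal (v a) * indicator X a \<partial>lborel)"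
    and h: "h \<in> borel_measurable borel"
  shows "(LINT a|lborel. v a * h a) = (LINT x|lborel. u x * h (T x))"
proof -
  have image: "distr (density lborel u) borel T = density lborel v"
  proof (rule measure_eqI)
    fix X assume "X \<in> sets (distr (density lborel u) borel T)"
    then have X: "X \<in> sets borel" by simp
    have "emeasure (distr (density lborel u) borel T) X = emeasure (density lborel u) (T -` X)"
      using X T by (simp add: emeasure_distr)
    also have "\<dots> = (\<integral>\<^sup>+x. ennreal (u x) * indicator X (T x) \<partial>lborel)"
      using X T u by (subst emeasure_density) (auto simp: measurable_sets_borel indicator_vimage[symmetric])
    also have "\<dots> = emeasure (density lborel v) X"
      using X v by (simp add: push emeasure_density)
    finally show "emeasure (distr (density lborel u) borel T) X = emeasure (density lborel v) X" .
  qed simp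
  have "(LINT a|lborel. v a * h a) = integral\<^sup>L (density lborel v) h"
    using v h by (simp add: integral_density)
  also have "\<dots> = integral\<^sup>L (density lborel u) (\<lambda>x. h (T x))"
    using T h by (simp add: image[symmetric] integral_distr)
  also have "\<dots> = (LINT x|lborel. u x * h (T x))"
    using T u h by (simp add: integral_density)
  finally show ?thesis .
qed

lemma integrable_continuous_on_compact_support:
  fixes f :: "'s::metric_space \<Rightarrow> 'b::{banach, second_countable_topology}"
  assumes "finite_measure M" and f: "f \<in> borel_measurable M" and K: "compact K"
    and support: "AE x in M. x \<in> K" and cont: "continuous_on K f"
  shows "integrable M f"
proof -
  obtain B where B: "\<forall>x\<in>K. norm (f x) \<le> B"
    using compact_imp_bounded[OF compact_continuous_image[OF cont K]] by (auto simp: bounded_iff)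
  have "AE x in M. norm (f x) \<le> B"
    using support by (rule eventually_mono) (use B in auto)
  then show ?thesis
    using finite_measure.integrable_const_bound[OF assms(1)] f by blast
qed

section \<open>Measurability of gradients of logarithms\<close>

lemma grad_not_differentiable:
  assumes "\<not> g differentiable (at x)"
  shows "grad g x = (\<Sum>b\<in>Basis. (SOME f'::'a::euclidean_space \<Rightarrow> real. False) b *\<^sub>R b)"
proof -
  have "\<And>f'. \<not> (g has_derivative f') (at x)"
    using assms by (auto simp: differentiable_def)
  then show ?thesis by (simp add: grad_def frechet_derivative_def)
qed

lemma not_isCont_diff_ln_at_zero:
  fixes A G :: "'a::metric_space \<Rightarrow> real"
  assumes A: "isCont A x" and G: "isCont G x" "G x = 0" and c: "c \<noteq> 0"
    and nonzero_near: "\<And>d. d > 0 \<Longrightarrow> \<exists>y. dist y x < d \<and> G y \<noteq> 0"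
  shows "\<not> isCont (\<lambda>y. A y - c * ln (G y)) x"
proof
  assume cont: "isCont (\<lambda>y. A y - c * ln (G y)) x"
  have "isCont (\<lambda>y. (A y - (A y - c * ln (G y))) / c) x"
    using continuous_divide[OF continuous_diff[OF A cont] continuous_const[of _ c]] c by simp
  moreover have "(\<lambda>y. (A y - (A y - c * ln (G y))) / c) = (\<lambda>y. ln (G y))"
    using c by auto
  ultimately have "isCont (\<lambda>y. ln (G y)) x"
    by simp
  then obtain d1 where d1: "d1 > 0" "\<And>y. dist y x < d1 \<Longrightarrow> \<bar>ln (G y)\<bar> < 1"
    using G(2) unfolding continuous_at_eps_delta by (metis dist_real_def diff_zero ln_0 zero_less_one)
  obtain d2 where d2: "d2 > 0" "\<And>y. dist y x < d2 \<Longrightarrow> \<bar>G y\<bar> < exp (-1)"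
    using G unfolding continuous_at_eps_delta by (metis dist_real_def diff_zero exp_gt_zero)
  obtain y where y: "dist y x < min d1 d2" "G y \<noteq> 0"
    using nonzero_near[of "min d1 d2"] d1(1) d2(1) by auto
  have "ln \<bar>G y\<bar> < ln (exp (-1))"
    using d2(2)[of y] y by (subst ln_less_cancel_iff) auto
  moreover have "ln \<bar>G y\<bar> = ln (G y)"
    by (simp add: abs_if ln_minus)
  ultimately show False
    using d1(2)[of y] y by simp
qed

lemma has_gradient_at_diff_ln:
  assumes a: "has_gradient_at a va x" and g: "has_gradient_at g vg x" and nonzero: "g x \<noteq> 0"
  shows "has_gradient_at (\<lambda>x. a x - c * ln (g x)) (va - (c * inverse (g x)) *\<^sub>R vg) x"
proof -
  have "((\<lambda>x. a x - c * ln (g x)) has_derivative (\<lambda>h. va \<bullet> h - c * ((inverse (g x) *\<^sub>R vg) \<bullet> h))) (at x)"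
    using a has_gradient_at_ln[OF g nonzero]
    by (intro has_derivative_diff has_derivative_mult_right) (simp_all add: has_gradient_at_def)
  then show ?thesis
    by (simp add: has_gradient_at_def inner_diff_left mult.assoc)
qed

text \<open>\<^const>\<open>grad\<close> is total: where the function is not differentiable it returns a fixed junk
  value. The second case below relies on the junk value \<open>ln 0 = 0\<close>; the third is where
  \<open>ln \<circ> G\<close> has a genuine singularity.\<close>

lemma grad_diff_ln_eq:
  fixes A G :: "'p::euclidean_space \<times> 'y::real_normed_vector \<Rightarrow> real"
  assumes A: "C1_on UNIV A" and G: "C1_on UNIV G" and c: "c \<noteq> 0"
  shows "grad (\<lambda>t. A (t, y) - c * ln (G (t, y))) \<theta> =
    (if G (\<theta>, y) \<noteq> 0 then grad (\<lambda>t. A (t, y)) \<theta> - (c * inverse (G (\<theta>, y))) *\<^sub>R grad (\<lambda>t. G (t, y)) \<theta>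
     else if \<exists>n::nat. \<forall>t\<in>ball \<theta> (1 / Suc n). G (t, y) = 0 then grad (\<lambda>t. A (t, y)) \<theta>
     else (\<Sum>b\<in>Basis. (SOME f'::'p \<Rightarrow> real. False) b *\<^sub>R b))"
proof -
  have gradA: "has_gradient_at (\<lambda>t. A (t, y)) (grad (\<lambda>t. A (t, y)) \<theta>) \<theta>"
    using C1_on_partial_grad(2)[OF A] by simp
  have gradG: "has_gradient_at (\<lambda>t. G (t, y)) (grad (\<lambda>t. G (t, y)) \<theta>) \<theta>"
    using C1_on_partial_grad(2)[OF G] by simp
  consider (nonzero) "G (\<theta>, y) \<noteq> 0"
    | (vanishing) n :: nat where "G (\<theta>, y) = 0" "\<forall>t\<in>ball \<theta> (1 / Suc n). G (t, y) = 0"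
    | (singular) "G (\<theta>, y) = 0" "\<not> (\<exists>n::nat. \<forall>t\<in>ball \<theta> (1 / Suc n). G (t, y) = 0)"
    by blast
  then show ?thesis
  proof cases
    case nonzero
    then show ?thesis
      using has_gradient_at_diff_ln[OF gradA gradG nonzero] by (simp add: grad_eqI)
  next
    case (vanishing n)
    have "has_gradient_at (\<lambda>t. A (t, y) - c * ln (G (t, y))) (grad (\<lambda>t. A (t, y)) \<theta>) \<theta>"
      unfolding has_gradient_at_def
    proof (rule has_derivative_transform_within_open)
      show "A (t, y) = A (t, y) - c * ln (G (t, y))" if "t \<in> ball \<theta> (1 / Suc n)" for t
        using vanishing that by simp
    qed (use gradA in \<open>auto simp: has_gradient_at_def\<close>)
    then show ?thesis
      using vanishing by (auto simp: grad_eqI)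
  next
    case singular
    have "\<not> isCont (\<lambda>t. A (t, y) - c * ln (G (t, y))) \<theta>"
    proof (rule not_isCont_diff_ln_at_zero[where A="\<lambda>t. A (t, y)" and G="\<lambda>t. G (t, y)"])
      show "G (\<theta>, y) = 0" "c \<noteq> 0" using singular(1) c .
      show "isCont (\<lambda>t. A (t, y)) \<theta>" "isCont (\<lambda>t. G (t, y)) \<theta>"
        using gradA gradG by (auto simp: has_gradient_at_def intro: has_derivative_continuous)
      fix d :: real assume "d > 0"
      then obtain n :: nat where n: "1 / Suc n < d"
        using reals_Archimedean[of d] by (auto simp: inverse_eq_divide)
      have "\<exists>t\<in>ball \<theta> (1 / Suc n). G (t, y) \<noteq> 0"
        using singular(2) by blast
      then obtain t where "t \<in> ball \<theta> (1 / Suc n)" "G (t, y) \<noteq> 0" ..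
      then show "\<exists>t. dist t \<theta> < d \<and> G (t, y) \<noteq> 0"
        using n by (intro exI[of _ t]) (auto simp: dist_commute)
    qed
    then have "\<not> (\<lambda>t. A (t, y) - c * ln (G (t, y))) differentiable (at \<theta>)"
      using differentiable_imp_continuous_within by blast
    then show ?thesis
      unfolding if_not_P[OF singular(2)] using singular(1) by (simp add: grad_not_differentiable)
  qed
qed

lemma borel_measurable_grad_diff_ln:
  fixes A G :: "'p::euclidean_space \<times> 'y::euclidean_space \<Rightarrow> real"
  assumes A: "C1_on UNIV A" and G: "C1_on UNIV G" and c: "c \<noteq> 0"
  shows "(\<lambda>y. grad (\<lambda>t. A (t, y) - c * ln (G (t, y))) \<theta>) \<in> borel_measurable borel"
proof -
  have contG: "continuous_on UNIV (\<lambda>y. G (t, y))" for t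
    using continuous_on_compose2[OF C1_on_imp_continuous_on[OF G], of UNIV "\<lambda>y. (t, y)"]
    by (simp add: continuous_on_Pair)
  have "closed {y. \<forall>t\<in>ball \<theta> (1 / Suc n). G (t, y) = 0}" for n :: nat
  proof -
    have "{y. \<forall>t\<in>ball \<theta> (1 / Suc n). G (t, y) = 0} = (\<Inter>t\<in>ball \<theta> (1 / Suc n). {y. G (t, y) = 0})"
      by auto
    then show ?thesis
      using closed_Collect_eq[OF contG continuous_on_const] by auto
  qed
  then have "(\<Union>n::nat. {y. \<forall>t\<in>ball \<theta> (1 / Suc n). G (t, y) = 0}) \<in> sets borel"
    by (auto intro: borel_closed)
  moreover have "{y. \<exists>n::nat. \<forall>t\<in>ball \<theta> (1 / Suc n). G (t, y) = 0}
      = (\<Union>n::nat. {y. \<forall>t\<in>ball \<theta> (1 / Suc n). G (t, y) = 0})"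
    by auto
  ultimately have "{y. \<exists>n::nat. \<forall>t\<in>ball \<theta> (1 / Suc n). G (t, y) = 0} \<in> sets borel"
    by simp
  moreover have "{y. G (\<theta>, y) \<noteq> 0} \<in> sets borel"
    using open_Collect_neq[OF contG continuous_on_const] by (auto intro: borel_open)
  moreover have "continuous_on UNIV (\<lambda>y. grad (\<lambda>t. A (t, y)) \<theta>)"
    "continuous_on UNIV (\<lambda>y. grad (\<lambda>t. G (t, y)) \<theta>)"
    using continuous_on_compose2[OF C1_on_partial_grad(1)[OF A], of UNIV "\<lambda>y. (\<theta>, y)"]
      continuous_on_compose2[OF C1_on_partial_grad(1)[OF G], of UNIV "\<lambda>y. (\<theta>, y)"]
    by (simp_all add: continuous_on_Pair)
  ultimately have "(\<lambda>y. if y \<in> {y. G (\<theta>, y) \<noteq> 0}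
        then grad (\<lambda>t. A (t, y)) \<theta> - (c * inverse (G (\<theta>, y))) *\<^sub>R grad (\<lambda>t. G (t, y)) \<theta>
      else if y \<in> {y. \<exists>n::nat. \<forall>t\<in>ball \<theta> (1 / Suc n). G (t, y) = 0} then grad (\<lambda>t. A (t, y)) \<theta>
      else (\<Sum>b\<in>Basis. (SOME f'::'p \<Rightarrow> real. False) b *\<^sub>R b)) \<in> borel_measurable borel"
    using contG[of \<theta>]
    by (intro measurable_If_set borel_measurable_diff borel_measurable_scaleR borel_measurable_times
        borel_measurable_inverse borel_measurable_continuous_onI) auto
  then show ?thesis
    by (simp only: mem_Collect_eq grad_diff_ln_eq[OF A G c])
qed

section \<open>Reparameterized mixture policies\<close>

locale reparameterized_mixture =
  fixes S :: "'s::euclidean_space set" and A :: "'a::euclidean_space set"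
    and E :: "'e::euclidean_space set" and N :: nat
    and piw :: "'p::euclidean_space \<Rightarrow> 's \<Rightarrow> nat \<Rightarrow> real"
    and pic :: "'p \<Rightarrow> 's \<Rightarrow> nat \<Rightarrow> 'a \<Rightarrow> real"
    and f :: "'p \<Rightarrow> 's \<Rightarrow> nat \<Rightarrow> 'e \<Rightarrow> 'a"
    and p :: "'e \<Rightarrow> real" and Q :: "'s \<Rightarrow> 'a \<Rightarrow> real"
    and B :: "'s measure" and \<alpha> :: real
  assumes S_compact: "compact S" and A_compact: "compact A" and E_compact: "compact E"
    and N_pos: "N \<ge> 1" and alpha_nonzero: "\<alpha> \<noteq> 0"
    and B_prob: "prob_space B" and B_sets: "sets B = sets borel" and B_supp: "AE s in B. s \<in> S"
    and piw_pos: "\<And>\<theta> s k. s \<in> S \<Longrightarrow> k \<in> {1..N} \<Longrightarrow> piw \<theta> s k > 0"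
    and pic_pos: "\<And>\<theta> s k a. s \<in> S \<Longrightarrow> k \<in> {1..N} \<Longrightarrow> a \<in> A \<Longrightarrow> pic \<theta> s k a > 0"
    and p_nonneg: "\<And>\<epsilon>. \<epsilon> \<in> E \<Longrightarrow> p \<epsilon> \<ge> 0"
    and reparam: "\<And>\<theta> s k X. s \<in> S \<Longrightarrow> k \<in> {1..N} \<Longrightarrow> X \<in> sets borel \<Longrightarrow>
        (\<integral>\<^sup>+\<epsilon>. ennreal (indicator E \<epsilon> * p \<epsilon>) * indicator X (f \<theta> s k \<epsilon>) \<partial>lborel)
      = (\<integral>\<^sup>+a. ennreal (indicator A a * pic \<theta> s k a) * indicator X a \<partial>lborel)"
    and f_into: "\<And>\<theta> s k. s \<in> S \<Longrightarrow> k \<in> {1..N} \<Longrightarrow> f \<theta> s k ` E \<subseteq> A"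
    and f_C1: "\<And>k. k \<in> {1..N} \<Longrightarrow> C1_fun (\<lambda>(\<theta>, s, \<epsilon>). f \<theta> s k \<epsilon>)"
    and piw_C1: "\<And>k. k \<in> {1..N} \<Longrightarrow> C1_fun (\<lambda>(\<theta>, s). piw \<theta> s k)"
    and pic_C1: "\<And>k. k \<in> {1..N} \<Longrightarrow> C1_fun (\<lambda>(\<theta>, s, a). pic \<theta> s k a)"
    and p_C1: "C1_fun p"
    and Q_C1: "C1_fun (\<lambda>(s, a). Q s a)"
begin

abbreviation "pim \<equiv> mixture_policy N piw pic"

definition state_objective :: "'p \<Rightarrow> 's \<Rightarrow> real" where
  "state_objective \<theta> s = (LINT a:A|lborel. pim \<theta> s a * (Q s a - \<alpha> * ln (pim \<theta> s a)))"

definition reparam_value :: "nat \<Rightarrow> 'p \<Rightarrow> 's \<Rightarrow> 'e \<Rightarrow> real" where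
  "reparam_value k \<theta> s \<epsilon> = Q s (f \<theta> s k \<epsilon>) - \<alpha> * ln (pim \<theta> s (f \<theta> s k \<epsilon>))"

definition component_value :: "nat \<Rightarrow> 'p \<Rightarrow> 's \<Rightarrow> real" where
  "component_value k \<theta> s = (LINT \<epsilon>:E|lborel. p \<epsilon> * reparam_value k \<theta> s \<epsilon>)"

definition component_grad :: "nat \<Rightarrow> 'p \<Rightarrow> 's \<Rightarrow> 'p" where
  "component_grad k \<theta> s = (LINT \<epsilon>:E|lborel. p \<epsilon> *\<^sub>R grad (\<lambda>t. reparam_value k t s \<epsilon>) \<theta>)"

definition policy_gradient :: "'p \<Rightarrow> 's \<Rightarrow> 'p" where
  "policy_gradient \<theta> s = (\<Sum>k=1..N. piw \<theta> s k *\<^sub>R (LINT \<epsilon>:E|lborel. p \<epsilon> *\<^sub>R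
      (reparam_value k \<theta> s \<epsilon> *\<^sub>R grad (\<lambda>t. ln (piw t s k)) \<theta> + grad (\<lambda>t. reparam_value k t s \<epsilon>) \<theta>)))"

text \<open>In the notation of the introduction, \<^term>\<open>reparam_value k\<close> is \<open>\<Phi>\<^sub>k\<close> and
  \<^term>\<open>component_value k\<close> is \<open>V\<^sub>k\<close>; \<^const>\<open>policy_gradient\<close> is the integrand of the theorem.\<close>

lemma pim_pos: "s \<in> S \<Longrightarrow> a \<in> A \<Longrightarrow> pim \<theta> s a > 0"
  unfolding mixture_policy_def using N_pos piw_pos pic_pos
  by (intro sum_pos) (auto intro!: mult_pos_pos)

lemma p_continuous: "continuous_on U p"
  using p_C1 by (rule C1_fun_imp_continuous_on)

lemma f_C1_on: "k \<in> {1..N} \<Longrightarrow> C1_on U (\<lambda>x. f (fst x) (fst (snd x)) k (snd (snd x)))"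
  using C1_fun_imp_C1_on[OF f_C1] by (simp add: case_prod_beta')

lemma piw_C1_on: "k \<in> {1..N} \<Longrightarrow> C1_on U (\<lambda>x. piw (fst x) (snd x) k)"
  using C1_fun_imp_C1_on[OF piw_C1] by (simp add: case_prod_beta')

lemma Q_C1_on:
  "C1_on U a \<Longrightarrow> C1_on U (\<lambda>x. Q (fst (snd x)) (a x))"
  using C1_on_compose[OF Q_C1 C1_on_Pair[OF C1_on_fst[OF C1_on_snd[OF C1_on_id]]]] by simp

lemma pim_C1_on:
  assumes a: "C1_on U a"
  shows "C1_on U (\<lambda>x. pim (fst x) (fst (snd x)) (a x))"
proof -
  have "C1_on U (\<lambda>x. piw (fst x) (fst (snd x)) j)" if "j \<in> {1..N}" for j
    using C1_on_compose[OF piw_C1[OF that]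
        C1_on_Pair[OF C1_on_fst[OF C1_on_id] C1_on_fst[OF C1_on_snd[OF C1_on_id]]]]
    by simp
  moreover have "C1_on U (\<lambda>x. pic (fst x) (fst (snd x)) j (a x))" if "j \<in> {1..N}" for j
    using C1_on_compose[OF pic_C1[OF that] C1_on_Pair[OF C1_on_fst[OF C1_on_id]
          C1_on_Pair[OF C1_on_fst[OF C1_on_snd[OF C1_on_id]] a]]]
    by simp
  ultimately show ?thesis
    unfolding mixture_policy_def by (intro C1_on_sum C1_on_mult) auto
qed

lemma pim_continuous: "continuous_on U (\<lambda>z. pim \<theta> (fst z) (snd z))"
proof -
  have "continuous_on UNIV (\<lambda>x::'p \<times> 's \<times> 'a. pim (fst x) (fst (snd x)) (snd (snd x)))"
    by (intro C1_on_imp_continuous_on pim_C1_on C1_on_snd C1_on_id)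
  from continuous_on_compose2[OF this, of U "\<lambda>z. (\<theta>, z)"] show ?thesis
    by (simp add: continuous_on_Pair)
qed

lemma Q_continuous: "continuous_on U (\<lambda>z. Q (fst z) (snd z))"
  using C1_fun_imp_continuous_on[OF Q_C1] by (simp add: case_prod_beta')

lemma f_continuous: "k \<in> {1..N} \<Longrightarrow> continuous_on U (f \<theta> s k)"
  using continuous_on_compose2[OF C1_on_imp_continuous_on[OF f_C1_on[of k UNIV]], of U "\<lambda>\<epsilon>. (\<theta>, s, \<epsilon>)"]
  by (simp add: continuous_on_Pair)

lemma pic_continuous:
  assumes "k \<in> {1..N}"
  shows "continuous_on U (pic \<theta> s k)"
proof -
  have "continuous_on UNIV (\<lambda>(\<theta>, s, a). pic \<theta> s k a)"
    using pic_C1[OF assms] by (rule C1_fun_imp_continuous_on)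
  from continuous_on_compose2[OF this, of U "\<lambda>a. (\<theta>, s, a)"] show ?thesis
    by (simp add: continuous_on_Pair)
qed

lemma reparam_value_C1_on:
  assumes k: "k \<in> {1..N}"
  shows "C1_on (UNIV \<times> S \<times> E) (\<lambda>x. reparam_value k (fst x) (fst (snd x)) (snd (snd x)))"
proof -
  have "pim (fst x) (fst (snd x)) (f (fst x) (fst (snd x)) k (snd (snd x))) \<noteq> 0"
    if x: "x \<in> UNIV \<times> S \<times> E" for x
  proof -
    have "f (fst x) (fst (snd x)) k (snd (snd x)) \<in> A"
      using f_into[OF _ k] x by (auto simp: mem_Times_iff)
    moreover have "fst (snd x) \<in> S"
      using x by (auto simp: mem_Times_iff)
    ultimately show ?thesis
      using pim_pos by (metis less_irrefl)
  qed
  then show ?thesis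
    unfolding reparam_value_def
    by (intro C1_on_diff C1_on_mult C1_on_const Q_C1_on C1_on_ln pim_C1_on f_C1_on[OF k])
qed

lemma reparam_value_continuous:
  "k \<in> {1..N} \<Longrightarrow> continuous_on (UNIV \<times> S \<times> E) (\<lambda>x. reparam_value k (fst x) (fst (snd x)) (snd (snd x)))"
  using reparam_value_C1_on by (rule C1_on_imp_continuous_on)

lemma reparam_grad_continuous:
  "k \<in> {1..N} \<Longrightarrow>
    continuous_on (UNIV \<times> S \<times> E) (\<lambda>x. grad (\<lambda>t. reparam_value k t (fst (snd x)) (snd (snd x))) (fst x))"
  using C1_on_partial_grad(1)[OF reparam_value_C1_on] by simp

lemma reparam_value_has_gradient:
  "k \<in> {1..N} \<Longrightarrow> s \<in> S \<Longrightarrow> \<epsilon> \<in> E \<Longrightarrow>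
    has_gradient_at (\<lambda>t. reparam_value k t s \<epsilon>) (grad (\<lambda>t. reparam_value k t s \<epsilon>) \<theta>) \<theta>"
  using C1_on_partial_grad(2)[OF reparam_value_C1_on, of k \<theta> "(s, \<epsilon>)"] by simp

lemma component_pushforward:
  assumes s: "s \<in> S" and k: "k \<in> {1..N}" and h: "h \<in> borel_measurable borel"
  shows "(LINT a|lborel. indicator A a * pic \<theta> s k a * h a)
    = (LINT \<epsilon>|lborel. indicator E \<epsilon> * p \<epsilon> * h (f \<theta> s k \<epsilon>))"
proof (rule integral_density_pushforward)
  show "f \<theta> s k \<in> borel_measurable borel"
    using f_continuous[OF k] by (rule borel_measurable_continuous_onI)
  show "(\<lambda>\<epsilon>. indicator E \<epsilon> * p \<epsilon>) \<in> borel_measurable borel"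
    using E_compact p_continuous
    by (intro borel_measurable_times borel_measurable_indicator borel_compact borel_measurable_continuous_onI)
  show "(\<lambda>a. indicator A a * pic \<theta> s k a) \<in> borel_measurable borel"
    using A_compact pic_continuous[OF k]
    by (intro borel_measurable_times borel_measurable_indicator borel_compact borel_measurable_continuous_onI)
  show "0 \<le> indicator E \<epsilon> * p \<epsilon>" for \<epsilon>
    using p_nonneg by (simp add: indicator_def)
  show "0 \<le> indicator A a * pic \<theta> s k a" for a
    using pic_pos[OF s k] by (simp add: indicator_def less_imp_le)
qed (use reparam[OF s k] h in auto)

lemma state_objective_eq:
  assumes s: "s \<in> S"
  shows "state_objective \<theta> s = (\<Sum>k=1..N. piw \<theta> s k * component_value k \<theta> s)"
proof -
  define h where "h a = Q s a - \<alpha> * ln (pim \<theta> s a)" for a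
  have cont: "continuous_on UNIV (Q s)" "continuous_on UNIV (pim \<theta> s)"
    using continuous_on_compose2[OF Q_continuous[of UNIV], of UNIV "\<lambda>a. (s, a)"]
      continuous_on_compose2[OF pim_continuous[of UNIV \<theta>], of UNIV "\<lambda>a. (s, a)"]
    by (simp_all add: continuous_on_Pair)
  then have h_meas: "h \<in> borel_measurable borel"
    unfolding h_def by (intro borel_measurable_diff borel_measurable_times borel_measurable_const
        borel_measurable_ln borel_measurable_continuous_onI)
  have "\<forall>a\<in>A. pim \<theta> s a \<noteq> 0"
    using pim_pos[OF s] by (metis less_irrefl)
  then have h_cont: "continuous_on A h"
    unfolding h_def using cont by (intro continuous_intros) (auto intro: continuous_on_subset)
  have int: "integrable lborel (\<lambda>a. indicator A a * pic \<theta> s k a * h a)" if k: "k \<in> {1..N}" for k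
  proof -
    have "continuous_on A (\<lambda>a. pic \<theta> s k a * h a)"
      using pic_continuous[OF k] h_cont by (intro continuous_intros)
    from borel_integrable_compact[OF A_compact this] show ?thesis
      by (simp add: mult.assoc)
  qed
  have push: "(LINT a|lborel. indicator A a * pic \<theta> s k a * h a) = component_value k \<theta> s"
    if k: "k \<in> {1..N}" for k
    using component_pushforward[OF s k h_meas]
    by (simp add: component_value_def set_lebesgue_integral_def h_def reparam_value_def mult.assoc)
  have "state_objective \<theta> s = (LINT a|lborel. (\<Sum>k=1..N. piw \<theta> s k * (indicator A a * pic \<theta> s k a * h a)))"
    unfolding state_objective_def set_lebesgue_integral_def h_def mixture_policy_def
    by (simp add: sum_distrib_left sum_distrib_right ac_simps)
  also have "\<dots> = (\<Sum>k=1..N. piw \<theta> s k * (LINT a|lborel. indicator A a * pic \<theta> s k a * h a))"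
    using int by (simp add: Bochner_Integration.integral_sum)
  also have "\<dots> = (\<Sum>k=1..N. piw \<theta> s k * component_value k \<theta> s)"
    using push by simp
  finally show ?thesis .
qed

lemma set_integrable_weighted:
  fixes g :: "'e \<Rightarrow> 'b::euclidean_space"
  shows "continuous_on E g \<Longrightarrow> set_integrable lborel E (\<lambda>\<epsilon>. p \<epsilon> *\<^sub>R g \<epsilon>)"
  unfolding set_integrable_def
  by (intro borel_integrable_compact[OF E_compact] continuous_intros p_continuous)

lemma reparam_slice_continuous:
  assumes k: "k \<in> {1..N}" and s: "s \<in> S"
  shows "continuous_on E (\<lambda>\<epsilon>. reparam_value k t s \<epsilon>)"
    and "continuous_on E (\<lambda>\<epsilon>. grad (\<lambda>t. reparam_value k t s \<epsilon>) t)"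
proof -
  have slice: "continuous_on E (\<lambda>\<epsilon>. (t, s, \<epsilon>))" "(\<lambda>\<epsilon>. (t, s, \<epsilon>)) ` E \<subseteq> UNIV \<times> S \<times> E"
    using s by (auto simp: continuous_on_Pair)
  show "continuous_on E (\<lambda>\<epsilon>. reparam_value k t s \<epsilon>)"
    using continuous_on_compose2[OF reparam_value_continuous[OF k] slice] by simp
  show "continuous_on E (\<lambda>\<epsilon>. grad (\<lambda>t. reparam_value k t s \<epsilon>) t)"
    using continuous_on_compose2[OF reparam_grad_continuous[OF k] slice] by simp
qed

lemma component_value_has_gradient:
  assumes k: "k \<in> {1..N}" and s: "s \<in> S"
  shows "has_gradient_at (\<lambda>t. component_value k t s) (component_grad k \<theta> s) \<theta>"
proof -
  have "has_gradient_at (\<lambda>t. LINT \<epsilon>|lborel. indicator E \<epsilon> * p \<epsilon> * reparam_value k t s \<epsilon>)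
      (LINT \<epsilon>|lborel. (indicator E \<epsilon> * p \<epsilon>) *\<^sub>R grad (\<lambda>t. reparam_value k t s \<epsilon>) \<theta>) \<theta>"
  proof (rule has_gradient_at_integral_compact[OF E_compact,
        where D="\<lambda>t \<epsilon>. grad (\<lambda>t. reparam_value k t s \<epsilon>) t"])
    show "AE \<epsilon> in lborel. \<epsilon> \<in> E \<or> indicator E \<epsilon> * p \<epsilon> = 0"
      by (rule AE_I2) (simp add: indicator_def)
    show "integrable lborel (\<lambda>\<epsilon>. indicator E \<epsilon> * p \<epsilon>)"
      using borel_integrable_compact[OF E_compact p_continuous] by simp
    show "integrable lborel (\<lambda>\<epsilon>. indicator E \<epsilon> * p \<epsilon> * reparam_value k t s \<epsilon>)" for t
      using set_integrable_weighted[OF reparam_slice_continuous(1)[OF k s, of t]]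
      by (simp add: set_integrable_def mult.assoc)
    show "integrable lborel (\<lambda>\<epsilon>. (indicator E \<epsilon> * p \<epsilon>) *\<^sub>R grad (\<lambda>t. reparam_value k t s \<epsilon>) \<theta>)"
      using set_integrable_weighted[OF reparam_slice_continuous(2)[OF k s, of \<theta>]]
      by (simp add: set_integrable_def)
    show "has_gradient_at (\<lambda>t. reparam_value k t s \<epsilon>) (grad (\<lambda>t. reparam_value k t s \<epsilon>) t) t"
      if "\<epsilon> \<in> E" for t \<epsilon>
      using reparam_value_has_gradient[OF k s that] .
    have "continuous_on (UNIV \<times> E) (\<lambda>z. (fst z, s, snd z))" "(\<lambda>z. (fst z, s, snd z)) ` (UNIV \<times> E) \<subseteq> UNIV \<times> S \<times> E"
      using s by (auto intro!: continuous_intros)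
    from continuous_on_compose2[OF reparam_grad_continuous[OF k] this]
    show "continuous_on (UNIV \<times> E) (\<lambda>z. grad (\<lambda>t. reparam_value k t s (snd z)) (fst z))"
      by simp
  qed
  then show ?thesis
    by (simp add: component_value_def component_grad_def set_lebesgue_integral_def mult.assoc)
qed

lemma piw_has_gradient:
  "k \<in> {1..N} \<Longrightarrow> has_gradient_at (\<lambda>t. piw t s k) (grad (\<lambda>t. piw t s k) \<theta>) \<theta>"
  using C1_on_partial_grad(2)[OF piw_C1_on[of k UNIV], of \<theta> s] by simp

lemma piw_grad_continuous:
  "k \<in> {1..N} \<Longrightarrow> continuous_on U (\<lambda>z. grad (\<lambda>t. piw t (snd z) k) (fst z))"
  using C1_on_partial_grad(1)[OF piw_C1_on[of k UNIV]] continuous_on_subset by fastforce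

lemma grad_ln_piw:
  assumes k: "k \<in> {1..N}" and s: "s \<in> S"
  shows "grad (\<lambda>t. ln (piw t s k)) \<theta> = inverse (piw \<theta> s k) *\<^sub>R grad (\<lambda>t. piw t s k) \<theta>"
  using piw_pos[OF s k, of \<theta>] by (intro grad_eqI has_gradient_at_ln piw_has_gradient[OF k]) simp

text \<open>The log-derivative identity \<open>\<pi>\<^sup>w \<nabla> log \<pi>\<^sup>w = \<nabla> \<pi>\<^sup>w\<close> turns the score-function term of
  \<^const>\<open>policy_gradient\<close> into the product rule for \<open>\<Sum>\<^sub>k \<pi>\<^sup>w\<^sub>k V\<^sub>k\<close>.\<close>

lemma policy_gradient_eq:
  assumes s: "s \<in> S"
  shows "policy_gradient \<theta> s = (\<Sum>k=1..N.
    component_value k \<theta> s *\<^sub>R grad (\<lambda>t. piw t s k) \<theta> + piw \<theta> s k *\<^sub>R component_grad k \<theta> s)"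
  unfolding policy_gradient_def
proof (rule sum.cong[OF refl])
  fix k assume k: "k \<in> {1..N}"
  let ?gl = "grad (\<lambda>t. ln (piw t s k)) \<theta>"
  have "(LINT \<epsilon>:E|lborel. p \<epsilon> *\<^sub>R
      (reparam_value k \<theta> s \<epsilon> *\<^sub>R ?gl + grad (\<lambda>t. reparam_value k t s \<epsilon>) \<theta>))
    = (LINT \<epsilon>:E|lborel. (p \<epsilon> * reparam_value k \<theta> s \<epsilon>) *\<^sub>R ?gl)
      + (LINT \<epsilon>:E|lborel. p \<epsilon> *\<^sub>R grad (\<lambda>t. reparam_value k t s \<epsilon>) \<theta>)"
    using set_integrable_weighted[OF reparam_slice_continuous(1)[OF k s, of \<theta>]]
      set_integrable_weighted[OF reparam_slice_continuous(2)[OF k s, of \<theta>]]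
    by (subst set_integral_add(2)[symmetric]) (auto simp: scaleR_add_right)
  also have "\<dots> = component_value k \<theta> s *\<^sub>R ?gl + component_grad k \<theta> s"
    using set_integrable_weighted[OF reparam_slice_continuous(1)[OF k s, of \<theta>]]
    unfolding component_value_def component_grad_def set_integrable_def set_lebesgue_integral_def
    by (subst integral_scaleR_left[symmetric]) (auto intro!: Bochner_Integration.integral_cong)
  finally show "piw \<theta> s k *\<^sub>R (LINT \<epsilon>:E|lborel. p \<epsilon> *\<^sub>R
      (reparam_value k \<theta> s \<epsilon> *\<^sub>R ?gl + grad (\<lambda>t. reparam_value k t s \<epsilon>) \<theta>))
    = component_value k \<theta> s *\<^sub>R grad (\<lambda>t. piw t s k) \<theta> + piw \<theta> s k *\<^sub>R component_grad k \<theta> s"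
    using piw_pos[OF s k, of \<theta>] by (simp add: grad_ln_piw[OF k s] scaleR_add_right)
qed

lemma state_objective_has_gradient:
  assumes s: "s \<in> S"
  shows "has_gradient_at (\<lambda>t. state_objective t s) (policy_gradient \<theta> s) \<theta>"
proof -
  have "((\<lambda>t. \<Sum>k=1..N. piw t s k * component_value k t s) has_derivative (\<lambda>h. \<Sum>k=1..N.
      piw \<theta> s k * (component_grad k \<theta> s \<bullet> h) + (grad (\<lambda>t. piw t s k) \<theta> \<bullet> h) * component_value k \<theta> s))
    (at \<theta>)"
    using piw_has_gradient component_value_has_gradient[OF _ s]
    by (intro has_derivative_sum has_derivative_mult) (auto simp: has_gradient_at_def)
  then show ?thesis
    by (simp add: has_gradient_at_def state_objective_eq[OF s] policy_gradient_eq[OF s]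
        inner_sum_left inner_add_left ac_simps)
qed

lemma component_continuous:
  assumes k: "k \<in> {1..N}"
  shows "continuous_on (UNIV \<times> S) (\<lambda>z. component_value k (fst z) (snd z))"
    and "continuous_on (UNIV \<times> S) (\<lambda>z. component_grad k (fst z) (snd z))"
proof -
  have reshape: "continuous_on ((UNIV \<times> S) \<times> E) (\<lambda>z. (fst (fst z), snd (fst z), snd z))"
    "(\<lambda>z. (fst (fst z), snd (fst z), snd z)) ` ((UNIV \<times> S) \<times> E) \<subseteq> UNIV \<times> S \<times> E"
    by (auto intro!: continuous_intros)
  show "continuous_on (UNIV \<times> S) (\<lambda>z. component_value k (fst z) (snd z))"
    using continuous_on_parametric_set_integral[OF E_compact
        continuous_on_compose2[OF reparam_value_continuous[OF k] reshape] p_continuous]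
    by (simp add: component_value_def)
  show "continuous_on (UNIV \<times> S) (\<lambda>z. component_grad k (fst z) (snd z))"
    using continuous_on_parametric_set_integral[OF E_compact
        continuous_on_compose2[OF reparam_grad_continuous[OF k] reshape] p_continuous]
    by (simp add: component_grad_def)
qed

lemma piw_continuous: "k \<in> {1..N} \<Longrightarrow> continuous_on U (\<lambda>z. piw (fst z) (snd z) k)"
  using piw_C1_on by (rule C1_on_imp_continuous_on)

lemma policy_gradient_continuous:
  "continuous_on (UNIV \<times> S) (\<lambda>z. policy_gradient (fst z) (snd z))"
proof -
  have "continuous_on (UNIV \<times> S) (\<lambda>z. \<Sum>k=1..N. component_value k (fst z) (snd z) *\<^sub>R
      grad (\<lambda>t. piw t (snd z) k) (fst z) + piw (fst z) (snd z) k *\<^sub>R component_grad k (fst z) (snd z))"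
    by (intro continuous_intros component_continuous piw_grad_continuous piw_continuous) auto
  then show ?thesis
    by (rule continuous_on_eq) (auto simp: policy_gradient_eq)
qed

lemma state_objective_continuous: "continuous_on S (state_objective \<theta>)"
proof -
  have slice: "continuous_on S (\<lambda>s. (\<theta>, s))" "(\<lambda>s. (\<theta>, s)) ` S \<subseteq> UNIV \<times> S"
    by (auto simp: continuous_on_Pair)
  have "continuous_on S (\<lambda>s. \<Sum>k=1..N. piw \<theta> s k * component_value k \<theta> s)"
    using continuous_on_compose2[OF piw_continuous slice]
      continuous_on_compose2[OF component_continuous(1) slice]
    by (intro continuous_intros) auto
  then show ?thesis
    by (rule continuous_on_eq) (simp add: state_objective_eq)
qed

lemma state_objective_measurable: "state_objective \<theta> \<in> borel_measurable borel"
proof -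
  have "(\<lambda>z. pim \<theta> (fst z) (snd z) * (Q (fst z) (snd z) - \<alpha> * ln (pim \<theta> (fst z) (snd z))))
      \<in> borel_measurable borel"
    using pim_continuous Q_continuous
    by (intro borel_measurable_times borel_measurable_diff borel_measurable_const borel_measurable_ln
        borel_measurable_continuous_onI)
  from borel_measurable_parametric_set_integral[OF this borel_compact[OF A_compact]] show ?thesis
    by (simp add: state_objective_def[abs_def])
qed

lemma reparam_value_measurable:
  assumes k: "k \<in> {1..N}"
  shows "(\<lambda>z. reparam_value k \<theta> (fst z) (snd z)) \<in> borel_measurable borel"
proof -
  have slice: "continuous_on UNIV (\<lambda>z::'s \<times> 'e. (\<theta>, z))"
    by (simp add: continuous_on_Pair)
  have "(\<lambda>z. Q (fst z) (f \<theta> (fst z) k (snd z))) \<in> borel_measurable borel"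
    "(\<lambda>z. pim \<theta> (fst z) (f \<theta> (fst z) k (snd z))) \<in> borel_measurable borel"
    using continuous_on_compose2[OF C1_on_imp_continuous_on[OF Q_C1_on[OF f_C1_on[OF k]]] slice]
      continuous_on_compose2[OF C1_on_imp_continuous_on[OF pim_C1_on[OF f_C1_on[OF k]]] slice]
    by (auto intro: borel_measurable_continuous_onI)
  then show ?thesis
    unfolding reparam_value_def by measurable
qed

lemma reparam_grad_measurable:
  assumes k: "k \<in> {1..N}"
  shows "(\<lambda>z. grad (\<lambda>t. reparam_value k t (fst z) (snd z)) \<theta>) \<in> borel_measurable borel"
  using borel_measurable_grad_diff_ln[OF Q_C1_on[OF f_C1_on[OF k]] pim_C1_on[OF f_C1_on[OF k]] alpha_nonzero,
      of \<theta>]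
  by (simp add: reparam_value_def[abs_def])

lemma grad_ln_piw_measurable:
  assumes k: "k \<in> {1..N}"
  shows "(\<lambda>s. grad (\<lambda>t. ln (piw t s k)) \<theta>) \<in> borel_measurable borel"
proof -
  have "(\<lambda>s. grad (\<lambda>t. (\<lambda>x. 0) (t, s) - (-1) * ln ((\<lambda>x. piw (fst x) (snd x) k) (t, s))) \<theta>)
      \<in> borel_measurable borel"
    by (rule borel_measurable_grad_diff_ln[OF C1_on_const piw_C1_on[OF k]]) simp
  then show ?thesis
    by simp
qed

lemma policy_gradient_measurable: "policy_gradient \<theta> \<in> borel_measurable borel"
proof -
  have "(\<lambda>s. LINT \<epsilon>:E|lborel. p \<epsilon> *\<^sub>R
      (reparam_value k \<theta> s \<epsilon> *\<^sub>R grad (\<lambda>t. ln (piw t s k)) \<theta> + grad (\<lambda>t. reparam_value k t s \<epsilon>) \<theta>))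
    \<in> borel_measurable borel" if k: "k \<in> {1..N}" for k
  proof -
    have "(\<lambda>z. p (snd z) *\<^sub>R (reparam_value k \<theta> (fst z) (snd z) *\<^sub>R grad (\<lambda>t. ln (piw t (fst z) k)) \<theta>
        + grad (\<lambda>t. reparam_value k t (fst z) (snd z)) \<theta>)) \<in> borel_measurable borel"
    proof (intro borel_measurable_scaleR borel_measurable_add)
      have fst: "fst \<in> borel_measurable (borel :: ('s \<times> 'e) measure)"
        and snd: "snd \<in> borel_measurable (borel :: ('s \<times> 'e) measure)"
        by (auto intro!: borel_measurable_continuous_onI continuous_intros)
      show "(\<lambda>z::'s \<times> 'e. p (snd z)) \<in> borel_measurable borel"
        using measurable_compose[OF snd borel_measurable_continuous_onI[OF p_continuous]] by simp
      show "(\<lambda>z::'s \<times> 'e. grad (\<lambda>t. ln (piw t (fst z) k)) \<theta>) \<in> borel_measurable borel"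
        using measurable_compose[OF fst grad_ln_piw_measurable[OF k]] by simp
    qed (use reparam_value_measurable[OF k] reparam_grad_measurable[OF k] in auto)
    from borel_measurable_parametric_set_integral[OF this borel_compact[OF E_compact]] show ?thesis
      by simp
  qed
  moreover have "(\<lambda>s. piw \<theta> s k) \<in> borel_measurable borel" if "k \<in> {1..N}" for k
    using continuous_on_compose2[OF piw_continuous[OF that], of UNIV "\<lambda>s. (\<theta>, s)"]
    by (auto intro: borel_measurable_continuous_onI simp: continuous_on_Pair)
  ultimately show ?thesis
    unfolding policy_gradient_def[abs_def] by (intro borel_measurable_sum borel_measurable_scaleR)
qed

lemma objective_has_gradient:
  "has_gradient_at (\<lambda>\<theta>. LINT s|B. state_objective \<theta> s) (LINT s|B. policy_gradient \<theta> s) \<theta>"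
proof -
  interpret prob_space B by (rule B_prob)
  note B_measurable = measurable_cong_sets[OF B_sets refl]
  have "continuous_on S (policy_gradient \<theta>)"
    using continuous_on_compose2[OF policy_gradient_continuous, of S "\<lambda>s. (\<theta>, s)"]
    by (auto simp: continuous_on_Pair)
  then have "integrable B (policy_gradient \<theta>)"
    using policy_gradient_measurable S_compact B_supp
    by (intro integrable_continuous_on_compact_support) (auto simp: B_measurable finite_measure_axioms)
  moreover have "integrable B (state_objective t)" for t
    using state_objective_measurable state_objective_continuous S_compact B_supp
    by (intro integrable_continuous_on_compact_support) (auto simp: B_measurable finite_measure_axioms)
  ultimately have "has_gradient_at (\<lambda>t. LINT s|B. 1 * state_objective t s) (LINT s|B. 1 *\<^sub>R policy_gradient \<theta> s) \<theta>"
    using B_supp state_objective_has_gradient policy_gradient_continuous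
    by (intro has_gradient_at_integral_compact[OF S_compact]) auto
  then show ?thesis
    by simp
qed

end

lemma (in prob_space) AE_mem_imp_nonempty: "AE x in M. x \<in> S \<Longrightarrow> S \<noteq> {}"
  using AE_False by auto

lemma compact_domain_of_continuous_inverse:
  assumes A: "compact A" and g: "continuous_on A g" and f: "bij_betw f E A"
    and g_f: "\<And>x. x \<in> E \<Longrightarrow> g (f x) = x"
  shows "compact E"
proof -
  have "E = g ` A"
    using f g_f by (force simp: bij_betw_def)
  then show ?thesis
    using compact_continuous_image[OF g A] by simp
qed

theorem propositionC5:
  fixes S :: "'s::euclidean_space set" and A :: "'a::euclidean_space set"
    and E :: "'e::euclidean_space set"
    and N :: nat
    and piw :: "'p::euclidean_space \<Rightarrow> 's \<Rightarrow> nat \<Rightarrow> real"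
    and pic :: "'p \<Rightarrow> 's \<Rightarrow> nat \<Rightarrow> 'a \<Rightarrow> real"
    and f :: "'p \<Rightarrow> 's \<Rightarrow> nat \<Rightarrow> 'e \<Rightarrow> 'a"
    and finv :: "'p \<Rightarrow> 's \<Rightarrow> nat \<Rightarrow> 'a \<Rightarrow> 'e"
    and p :: "'e \<Rightarrow> real"
    and P :: "'s \<Rightarrow> 'a \<Rightarrow> 's \<Rightarrow> real" and d0 :: "'s \<Rightarrow> real" and r :: "'s \<Rightarrow> 'a \<Rightarrow> real"
    and Q :: "'s \<Rightarrow> 'a \<Rightarrow> real"
    and B :: "'s measure"
    and \<alpha> :: real
  assumes S_compact: "compact S" and A_compact: "compact A"
    and N_pos: "N \<ge> 1"
    and alpha_pos: "\<alpha> > 0"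
    and B_prob: "prob_space B" and B_sets: "sets B = sets borel" and B_supp: "AE s in B. s \<in> S"
    \<comment> \<open>pi^w(.|s) is a (positive) distribution on {1..N}\<close>
    and piw_pos: "\<And>\<theta> s k. s \<in> S \<Longrightarrow> k \<in> {1..N} \<Longrightarrow> piw \<theta> s k > 0"
    and piw_sum: "\<And>\<theta> s. s \<in> S \<Longrightarrow> (\<Sum>k=1..N. piw \<theta> s k) = 1"
    \<comment> \<open>component densities on A are positive\<close>
    and pic_pos: "\<And>\<theta> s k a. s \<in> S \<Longrightarrow> k \<in> {1..N} \<Longrightarrow> a \<in> A \<Longrightarrow> pic \<theta> s k a > 0"
    \<comment> \<open>noise epsilon has density p on E\<close>
    and p_nonneg: "\<And>\<epsilon>. \<epsilon> \<in> E \<Longrightarrow> p \<epsilon> \<ge> 0"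
    and p_prob: "(\<integral>\<^sup>+\<epsilon>. ennreal (indicator E \<epsilon> * p \<epsilon>) \<partial>lborel) = 1"
    \<comment> \<open>reparameterization: f(epsilon;s,k) ~ pi^c(.|s,k) for epsilon ~ p\<close>
    and reparam: "\<And>\<theta> s k X. s \<in> S \<Longrightarrow> k \<in> {1..N} \<Longrightarrow> X \<in> sets borel \<Longrightarrow>
        (\<integral>\<^sup>+\<epsilon>. ennreal (indicator E \<epsilon> * p \<epsilon>) * indicator X (f \<theta> s k \<epsilon>) \<partial>lborel)
      = (\<integral>\<^sup>+a. ennreal (indicator A a * pic \<theta> s k a) * indicator X a \<partial>lborel)"
    \<comment> \<open>f(.;s,k) is invertible with inverse finv(.;s,k)\<close>
    and f_bij: "\<And>\<theta> s k. s \<in> S \<Longrightarrow> k \<in> {1..N} \<Longrightarrow> bij_betw (f \<theta> s k) E A"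
    and finv_f: "\<And>\<theta> s k \<epsilon>. s \<in> S \<Longrightarrow> k \<in> {1..N} \<Longrightarrow> \<epsilon> \<in> E \<Longrightarrow> finv \<theta> s k (f \<theta> s k \<epsilon>) = \<epsilon>"
    and f_finv: "\<And>\<theta> s k a. s \<in> S \<Longrightarrow> k \<in> {1..N} \<Longrightarrow> a \<in> A \<Longrightarrow> f \<theta> s k (finv \<theta> s k a) = a"
    \<comment> \<open>regularity: all functions continuously differentiable\<close>
    and P_C1: "C1_fun (\<lambda>(s, a, s'). P s a s')"
    and d0_C1: "C1_fun d0"
    and r_C1: "C1_fun (\<lambda>(s, a). r s a)"
    and f_C1: "\<And>k. k \<in> {1..N} \<Longrightarrow> C1_fun (\<lambda>(\<theta>, s, \<epsilon>). f \<theta> s k \<epsilon>)"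
    and finv_C1: "\<And>k. k \<in> {1..N} \<Longrightarrow> C1_fun (\<lambda>(\<theta>, s, a). finv \<theta> s k a)"
    and piw_C1: "\<And>k. k \<in> {1..N} \<Longrightarrow> C1_fun (\<lambda>(\<theta>, s). piw \<theta> s k)"
    and pic_C1: "\<And>k. k \<in> {1..N} \<Longrightarrow> C1_fun (\<lambda>(\<theta>, s, a). pic \<theta> s k a)"
    and p_C1: "C1_fun p"
    and Q_C1: "C1_fun (\<lambda>(s, a). Q s a)"
  shows "\<forall>\<theta>. has_gradient_at (Jhat B A Q \<alpha> (mixture_policy N piw pic))
     (LINT s|B. (\<Sum>k=1..N. piw \<theta> s k *\<^sub>R
        (LINT \<epsilon>:E|lborel. p \<epsilon> *\<^sub>R
          ((Q s (f \<theta> s k \<epsilon>) - \<alpha> * ln (mixture_policy N piw pic \<theta> s (f \<theta> s k \<epsilon>)))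
              *\<^sub>R grad (\<lambda>t. ln (piw t s k)) \<theta>
           + grad (\<lambda>t. Q s (f t s k \<epsilon>) - \<alpha> * ln (mixture_policy N piw pic t s (f t s k \<epsilon>))) \<theta>))))
     \<theta>"
proof -
  obtain s0 where s0: "s0 \<in> S"
    using prob_space.AE_mem_imp_nonempty[OF B_prob B_supp] by blast
  have k1: "1 \<in> {1..N}" using N_pos by simp
  have "continuous_on UNIV (\<lambda>(\<theta>, s, a). finv \<theta> s 1 a)"
    using finv_C1[OF k1] by (rule C1_fun_imp_continuous_on)
  from continuous_on_compose2[OF this, of A "\<lambda>a. (0, s0, a)"]
  have "continuous_on A (finv 0 s0 1)"
    by (simp add: continuous_on_Pair)
  then have "compact E"
    using finv_f[OF s0 k1] by (intro compact_domain_of_continuous_inverse[OF A_compact _ f_bij[OF s0 k1]])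
  moreover have "f \<theta> s k ` E \<subseteq> A" if "s \<in> S" "k \<in> {1..N}" for \<theta> s k
    using f_bij[OF that] by (simp add: bij_betw_def)
  ultimately interpret reparameterized_mixture S A E N piw pic f p Q B \<alpha>
    using alpha_pos
    by (intro reparameterized_mixture.intro S_compact A_compact N_pos B_prob B_sets B_supp piw_pos
        pic_pos p_nonneg reparam f_C1 piw_C1 pic_C1 p_C1 Q_C1) auto
  show ?thesis
    using objective_has_gradient
    by (simp add: Jhat_def[abs_def] state_objective_def policy_gradient_def reparam_value_def)
qed

end
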